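(* Let $\mathbb{P},\mathbb{Q}$ be props, let $F\colon\mathbb{P}\to\mathbb{Q}$ be a prop functor, and let $\mathcal{C}$ be a symmetric monoidal category. For any supply $s$ of $\mathbb{Q}$ in $\mathcal{C}$, the family of composites $s_c\circ F\colon\mathbb{P}\to\mathbb{Q}\to\mathcal{C}$, for $c\in\mathcal{C}$, is a supply of $\mathbb{P}$ in $\mathcal{C}$.
   Context: Strong monoidal functors between symmetric monoidal categories are always understood to be symmetric; their structure isomorphisms are called strongators. In a symmetric monoidal category $(\mathcal{C},I,\otimes)$, write $b^{\otimes m}$ for the left-bracketed $m$-fold product $((b\otimes b)\otimes\cdots)\otimes b$, with $b^{\otimes 0}=I$ and $b^{\otimes 1}=b$. Write $\sigma\colon c^{\otimes n}\otimes d^{\otimes n}\to(c\otimes d)^{\otimes n}$ and $\sigma\colon I\to I^{\otimes n}$ for the canonical (Mac Lane coherence) isomorphisms, the first one realizing the evident shuffle permutation. A prop is a symmetric strict monoidal category whose monoid of objects is $(\mathbb{N},0,+)$. A prop functor is a strict symmetric monoidal functor between props sending $1\mapsto 1$. A supply $s$ of a prop $\mathbb{P}$ in $\mathcal{C}$ consists of a strong monoidal functor $s_c\colon\mathbb{P}\to\mathcal{C}$ for each object $c\in\mathcal{C}$ such that: (i) $s_c(m)=c^{\otimes m}$ for each $m\in\mathbb{N}$; (ii) the strongator $c^{\otimes m}\otimes c^{\otimes n}\to c^{\otimes(m+n)}$ is the unique coherence (rebracketing) isomorphism for each $m,n$; (iii) for all $c,d\in\mathcal{C}$ and $\mu\colon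 m\to n$ in $\mathbb{P}$, $s_{c\otimes d}(\mu)\circ\sigma=\sigma\circ(s_c(\mu)\otimes s_d(\mu))$ as maps $c^{\otimes m}\otimes d^{\otimes m}\to(c\otimes d)^{\otimes n}$, and $s_I(\mu)\circ\sigma=\sigma$ as maps $I\to I^{\otimes n}$. *)

theory Defs
  imports Main
begin

section \<open>Categories and symmetric monoidal categories\<close>

text \<open>Composition is written in the usual (right-to-left) order: \<open>g \<cdot> f\<close> is \<open>f\<close> followed by \<open>g\<close>.
  All operations are total functions whose values matter only on the carriers.\<close>

record ('o, 'a) category =
  Obj :: "'o set"
  Arr :: "'a set"
  Dom :: "'a \<Rightarrow> 'o"
  Cod :: "'a \<Rightarrow> 'o"
  Ident :: "'o \<Rightarrow> 'a"
  Comp :: "'a \<Rightarrow> 'a \<Rightarrow> 'a"  (infixl "\<cdot>\<index>" 55)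

definition hom :: "('o, 'a, 'x) category_scheme \<Rightarrow> 'o \<Rightarrow> 'o \<Rightarrow> 'a set" where
  "hom C a b = {f \<in> Arr C. Dom C f = a \<and> Cod C f = b}"

locale category =
  fixes C :: "('o, 'a, 'x) category_scheme" (structure)
  assumes dom_obj: "f \<in> Arr C \<Longrightarrow> Dom C f \<in> Obj C"
    and cod_obj: "f \<in> Arr C \<Longrightarrow> Cod C f \<in> Obj C"
    and id_hom: "a \<in> Obj C \<Longrightarrow> Ident C a \<in> hom C a a"
    and comp_hom: "\<lbrakk>f \<in> hom C a b; g \<in> hom C b c\<rbrakk> \<Longrightarrow> g \<cdot> f \<in> hom C a c"
    and comp_id_right: "f \<in> hom C a b \<Longrightarrow> f \<cdot> Ident C a = f"
    and comp_id_left: "f \<in> hom C a b \<Longrightarrow> Ident C b \<cdot> f = f"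
    and comp_assoc: "\<lbrakk>f \<in> hom C a b; g \<in> hom C b c; h \<in> hom C c d\<rbrakk>
      \<Longrightarrow> h \<cdot> (g \<cdot> f) = (h \<cdot> g) \<cdot> f"

definition inverse_arrows :: "('o, 'a, 'x) category_scheme \<Rightarrow> 'a \<Rightarrow> 'a \<Rightarrow> bool" where
  "inverse_arrows C f g \<longleftrightarrow> f \<in> Arr C \<and> g \<in> hom C (Cod C f) (Dom C f)
     \<and> Comp C g f = Ident C (Dom C f) \<and> Comp C f g = Ident C (Cod C f)"

definition is_iso :: "('o, 'a, 'x) category_scheme \<Rightarrow> 'a \<Rightarrow> bool" where
  "is_iso C f \<longleftrightarrow> (\<exists>g. inverse_arrows C f g)"

definition inv_arr :: "('o, 'a, 'x) category_scheme \<Rightarrow> 'a \<Rightarrow> 'a" where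
  "inv_arr C f = (THE g. inverse_arrows C f g)"

lemma (in category) inverse_arrows_inv_arr:
  assumes "is_iso C f"
  shows "inverse_arrows C f (inv_arr C f)"
proof -
  obtain g where g: "inverse_arrows C f g"
    using assms by (auto simp: is_iso_def)
  have "h = g" if h: "inverse_arrows C f h" for h
  proof -
    have f: "f \<in> hom C (Dom C f) (Cod C f)"
      using g by (simp add: inverse_arrows_def hom_def)
    have gh: "g \<in> hom C (Cod C f) (Dom C f)" "h \<in> hom C (Cod C f) (Dom C f)"
      using g h by (simp_all add: inverse_arrows_def)
    have "h = h \<cdot> (f \<cdot> g)"
      using g gh comp_id_right by (simp add: inverse_arrows_def)
    also have "\<dots> = (h \<cdot> f) \<cdot> g"
      using comp_assoc f gh by blast
    also have "\<dots> = g"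
      using h gh comp_id_left by (simp add: inverse_arrows_def)
    finally show ?thesis .
  qed
  with g show ?thesis
    unfolding inv_arr_def by (metis theI)
qed

text \<open>\<open>\<otimes>\<close> is the tensor product on objects and \<open>\<boxtimes>\<close> the tensor product on arrows.\<close>

record ('o, 'a) monoidal = "('o, 'a) category" +
  TensorObj :: "'o \<Rightarrow> 'o \<Rightarrow> 'o"  (infixl "\<otimes>\<index>" 70)
  TensorArr :: "'a \<Rightarrow> 'a \<Rightarrow> 'a"  (infixl "\<boxtimes>\<index>" 70)
  Unit :: "'o"
  Assoc :: "'o \<Rightarrow> 'o \<Rightarrow> 'o \<Rightarrow> 'a"
  LUnit :: "'o \<Rightarrow> 'a"
  RUnit :: "'o \<Rightarrow> 'a"
  Braid :: "'o \<Rightarrow> 'o \<Rightarrow> 'a"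

locale symmetric_monoidal_category = category C
  for C :: "('o, 'a, 'x) monoidal_scheme" (structure) +
  assumes unit_obj: "Unit C \<in> Obj C"
    and tensor_obj: "\<lbrakk>a \<in> Obj C; b \<in> Obj C\<rbrakk> \<Longrightarrow> a \<otimes> b \<in> Obj C"
    and tensor_hom: "\<lbrakk>f \<in> hom C a b; g \<in> hom C c d\<rbrakk> \<Longrightarrow> f \<boxtimes> g \<in> hom C (a \<otimes> c) (b \<otimes> d)"
    and tensor_id: "\<lbrakk>a \<in> Obj C; b \<in> Obj C\<rbrakk> \<Longrightarrow> Ident C a \<boxtimes> Ident C b = Ident C (a \<otimes> b)"
    and tensor_comp: "\<lbrakk>f \<in> hom C a b; g \<in> hom C b c; f' \<in> hom C a' b'; g' \<in> hom C b' c'\<rbrakk>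
      \<Longrightarrow> (g \<cdot> f) \<boxtimes> (g' \<cdot> f') = (g \<boxtimes> g') \<cdot> (f \<boxtimes> f')"
    and assoc_hom: "\<lbrakk>a \<in> Obj C; b \<in> Obj C; c \<in> Obj C\<rbrakk>
      \<Longrightarrow> Assoc C a b c \<in> hom C ((a \<otimes> b) \<otimes> c) (a \<otimes> (b \<otimes> c))"
    and assoc_iso: "\<lbrakk>a \<in> Obj C; b \<in> Obj C; c \<in> Obj C\<rbrakk> \<Longrightarrow> is_iso C (Assoc C a b c)"
    and assoc_natural: "\<lbrakk>f \<in> hom C a a'; g \<in> hom C b b'; h \<in> hom C c c'\<rbrakk>
      \<Longrightarrow> Assoc C a' b' c' \<cdot> ((f \<boxtimes> g) \<boxtimes> h) = (f \<boxtimes> (g \<boxtimes> h)) \<cdot> Assoc C a b c"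
    and lunit_hom: "a \<in> Obj C \<Longrightarrow> LUnit C a \<in> hom C (Unit C \<otimes> a) a"
    and lunit_iso: "a \<in> Obj C \<Longrightarrow> is_iso C (LUnit C a)"
    and lunit_natural: "f \<in> hom C a b
      \<Longrightarrow> LUnit C b \<cdot> (Ident C (Unit C) \<boxtimes> f) = f \<cdot> LUnit C a"
    and runit_hom: "a \<in> Obj C \<Longrightarrow> RUnit C a \<in> hom C (a \<otimes> Unit C) a"
    and runit_iso: "a \<in> Obj C \<Longrightarrow> is_iso C (RUnit C a)"
    and runit_natural: "f \<in> hom C a b
      \<Longrightarrow> RUnit C b \<cdot> (f \<boxtimes> Ident C (Unit C)) = f \<cdot> RUnit C a"
    and braid_hom: "\<lbrakk>a \<in> Obj C; b \<in> Obj C\<rbrakk> \<Longrightarrow> Braid C a b \<in> hom C (a \<otimes> b) (b \<otimes> a)"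
    and braid_natural: "\<lbrakk>f \<in> hom C a a'; g \<in> hom C b b'\<rbrakk>
      \<Longrightarrow> Braid C a' b' \<cdot> (f \<boxtimes> g) = (g \<boxtimes> f) \<cdot> Braid C a b"
    and braid_braid: "\<lbrakk>a \<in> Obj C; b \<in> Obj C\<rbrakk> \<Longrightarrow> Braid C b a \<cdot> Braid C a b = Ident C (a \<otimes> b)"
    and pentagon: "\<lbrakk>a \<in> Obj C; b \<in> Obj C; c \<in> Obj C; d \<in> Obj C\<rbrakk>
      \<Longrightarrow> (Ident C a \<boxtimes> Assoc C b c d) \<cdot> Assoc C a (b \<otimes> c) d \<cdot> (Assoc C a b c \<boxtimes> Ident C d)
        = Assoc C a b (c \<otimes> d) \<cdot> Assoc C (a \<otimes> b) c d"
    and triangle: "\<lbrakk>a \<in> Obj C; b \<in> Obj C\<rbrakk>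
      \<Longrightarrow> (Ident C a \<boxtimes> LUnit C b) \<cdot> Assoc C a (Unit C) b = RUnit C a \<boxtimes> Ident C b"
    and hexagon: "\<lbrakk>a \<in> Obj C; b \<in> Obj C; c \<in> Obj C\<rbrakk>
      \<Longrightarrow> Assoc C b c a \<cdot> Braid C a (b \<otimes> c) \<cdot> Assoc C a b c
        = (Ident C b \<boxtimes> Braid C a c) \<cdot> Assoc C b a c \<cdot> (Braid C a b \<boxtimes> Ident C c)"

locale symmetric_strict_monoidal_category = symmetric_monoidal_category C
  for C :: "('o, 'a, 'x) monoidal_scheme" (structure) +
  assumes strict_assoc: "\<lbrakk>a \<in> Obj C; b \<in> Obj C; c \<in> Obj C\<rbrakk> \<Longrightarrow> (a \<otimes> b) \<otimes> c = a \<otimes> (b \<otimes> c)"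
    and strict_lunit: "a \<in> Obj C \<Longrightarrow> Unit C \<otimes> a = a"
    and strict_runit: "a \<in> Obj C \<Longrightarrow> a \<otimes> Unit C = a"
    and Assoc_id: "\<lbrakk>a \<in> Obj C; b \<in> Obj C; c \<in> Obj C\<rbrakk> \<Longrightarrow> Assoc C a b c = Ident C ((a \<otimes> b) \<otimes> c)"
    and LUnit_id: "a \<in> Obj C \<Longrightarrow> LUnit C a = Ident C a"
    and RUnit_id: "a \<in> Obj C \<Longrightarrow> RUnit C a = Ident C a"


section \<open>Strong monoidal functors\<close>

text \<open>\<open>Mult F a b : F a \<otimes> F b \<rightarrow> F (a \<otimes> b)\<close> and \<open>MultUnit F : I \<rightarrow> F I\<close> are the strongators.\<close>

record ('o1, 'a1, 'o2, 'a2) monoidal_functor =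
  ObjMap :: "'o1 \<Rightarrow> 'o2"
  ArrMap :: "'a1 \<Rightarrow> 'a2"
  Mult :: "'o1 \<Rightarrow> 'o1 \<Rightarrow> 'a2"
  MultUnit :: "'a2"

text \<open>Strong monoidal functors are understood to be symmetric.\<close>

locale strong_monoidal_functor =
  A: symmetric_monoidal_category A + B: symmetric_monoidal_category B
  for A :: "('o1, 'a1, 'x) monoidal_scheme"
    and B :: "('o2, 'a2, 'y) monoidal_scheme"
    and F :: "('o1, 'a1, 'o2, 'a2) monoidal_functor" +
  assumes map_obj: "a \<in> Obj A \<Longrightarrow> ObjMap F a \<in> Obj B"
    and map_hom: "f \<in> hom A a b \<Longrightarrow> ArrMap F f \<in> hom B (ObjMap F a) (ObjMap F b)"
    and map_id: "a \<in> Obj A \<Longrightarrow> ArrMap F (Ident A a) = Ident B (ObjMap F a)"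
    and map_comp: "\<lbrakk>f \<in> hom A a b; g \<in> hom A b c\<rbrakk>
      \<Longrightarrow> ArrMap F (g \<cdot>\<^bsub>A\<^esub> f) = ArrMap F g \<cdot>\<^bsub>B\<^esub> ArrMap F f"
    and mult_hom: "\<lbrakk>a \<in> Obj A; b \<in> Obj A\<rbrakk>
      \<Longrightarrow> Mult F a b \<in> hom B (ObjMap F a \<otimes>\<^bsub>B\<^esub> ObjMap F b) (ObjMap F (a \<otimes>\<^bsub>A\<^esub> b))"
    and mult_iso: "\<lbrakk>a \<in> Obj A; b \<in> Obj A\<rbrakk> \<Longrightarrow> is_iso B (Mult F a b)"
    and mult_natural: "\<lbrakk>f \<in> hom A a a'; g \<in> hom A b b'\<rbrakk>
      \<Longrightarrow> Mult F a' b' \<cdot>\<^bsub>B\<^esub> (ArrMap F f \<boxtimes>\<^bsub>B\<^esub> ArrMap F g)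
        = ArrMap F (f \<boxtimes>\<^bsub>A\<^esub> g) \<cdot>\<^bsub>B\<^esub> Mult F a b"
    and eps_hom: "MultUnit F \<in> hom B (Unit B) (ObjMap F (Unit A))"
    and eps_iso: "is_iso B (MultUnit F)"
    and mult_assoc: "\<lbrakk>a \<in> Obj A; b \<in> Obj A; c \<in> Obj A\<rbrakk>
      \<Longrightarrow> ArrMap F (Assoc A a b c) \<cdot>\<^bsub>B\<^esub> Mult F (a \<otimes>\<^bsub>A\<^esub> b) c \<cdot>\<^bsub>B\<^esub> (Mult F a b \<boxtimes>\<^bsub>B\<^esub> Ident B (ObjMap F c))
        = Mult F a (b \<otimes>\<^bsub>A\<^esub> c) \<cdot>\<^bsub>B\<^esub> (Ident B (ObjMap F a) \<boxtimes>\<^bsub>B\<^esub> Mult F b c)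
            \<cdot>\<^bsub>B\<^esub> Assoc B (ObjMap F a) (ObjMap F b) (ObjMap F c)"
    and mult_lunit: "a \<in> Obj A
      \<Longrightarrow> ArrMap F (LUnit A a) \<cdot>\<^bsub>B\<^esub> Mult F (Unit A) a \<cdot>\<^bsub>B\<^esub> (MultUnit F \<boxtimes>\<^bsub>B\<^esub> Ident B (ObjMap F a))
        = LUnit B (ObjMap F a)"
    and mult_runit: "a \<in> Obj A
      \<Longrightarrow> ArrMap F (RUnit A a) \<cdot>\<^bsub>B\<^esub> Mult F a (Unit A) \<cdot>\<^bsub>B\<^esub> (Ident B (ObjMap F a) \<boxtimes>\<^bsub>B\<^esub> MultUnit F)
        = RUnit B (ObjMap F a)"
    and mult_braid: "\<lbrakk>a \<in> Obj A; b \<in> Obj A\<rbrakk>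
      \<Longrightarrow> ArrMap F (Braid A a b) \<cdot>\<^bsub>B\<^esub> Mult F a b
        = Mult F b a \<cdot>\<^bsub>B\<^esub> Braid B (ObjMap F a) (ObjMap F b)"

locale strict_symmetric_monoidal_functor = strong_monoidal_functor A B F
  for A :: "('o1, 'a1, 'x) monoidal_scheme"
    and B :: "('o2, 'a2, 'y) monoidal_scheme"
    and F :: "('o1, 'a1, 'o2, 'a2) monoidal_functor" +
  assumes strict_tensor: "\<lbrakk>a \<in> Obj A; b \<in> Obj A\<rbrakk>
      \<Longrightarrow> ObjMap F (a \<otimes>\<^bsub>A\<^esub> b) = ObjMap F a \<otimes>\<^bsub>B\<^esub> ObjMap F b"
    and strict_unit: "ObjMap F (Unit A) = Unit B"
    and Mult_id: "\<lbrakk>a \<in> Obj A; b \<in> Obj A\<rbrakk>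
      \<Longrightarrow> Mult F a b = Ident B (ObjMap F a \<otimes>\<^bsub>B\<^esub> ObjMap F b)"
    and MultUnit_id: "MultUnit F = Ident B (Unit B)"

text \<open>The composite \<open>G \<circ> F\<close>, with \<open>G\<close> landing in \<open>C\<close>, and its usual strongators.\<close>

definition comp_functor :: "('o3, 'a3, 'x) monoidal_scheme \<Rightarrow> ('o2, 'a2, 'o3, 'a3) monoidal_functor
    \<Rightarrow> ('o1, 'a1, 'o2, 'a2) monoidal_functor \<Rightarrow> ('o1, 'a1, 'o3, 'a3) monoidal_functor" where
  "comp_functor C G F =
    \<lparr>ObjMap = ObjMap G \<circ> ObjMap F,
     ArrMap = ArrMap G \<circ> ArrMap F,
     Mult = (\<lambda>a b. ArrMap G (Mult F a b) \<cdot>\<^bsub>C\<^esub> Mult G (ObjMap F a) (ObjMap F b)),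
     MultUnit = ArrMap G (MultUnit F) \<cdot>\<^bsub>C\<^esub> MultUnit G\<rparr>"


section \<open>Props\<close>

locale prop_category = symmetric_strict_monoidal_category P
  for P :: "(nat, 'a, 'x) monoidal_scheme" (structure) +
  assumes prop_Obj: "Obj P = UNIV"
    and prop_Unit: "Unit P = 0"
    and prop_tensor: "m \<otimes> n = m + n"

locale prop_functor =
  P: prop_category P + Q: prop_category Q + strict_symmetric_monoidal_functor P Q F
  for P :: "(nat, 'p, 'x) monoidal_scheme"
    and Q :: "(nat, 'q, 'y) monoidal_scheme"
    and F :: "(nat, 'p, nat, 'q) monoidal_functor" +
  assumes map_one: "ObjMap F 1 = 1"


section \<open>Tensor powers and canonical isomorphisms\<close>

fun tensor_power :: "('o, 'a, 'x) monoidal_scheme \<Rightarrow> 'o \<Rightarrow> nat \<Rightarrow> 'o" where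
  "tensor_power C c 0 = Unit C"
| "tensor_power C c (Suc 0) = c"
| "tensor_power C c (Suc (Suc n)) = tensor_power C c (Suc n) \<otimes>\<^bsub>C\<^esub> c"

text \<open>The three families below are explicit composites of structure isomorphisms; by Mac Lane
  coherence any other such composite with the same underlying permutation is equal to them.  The
  lemmas at the end of this section confirm that they are structural with the intended
  permutations.\<close>

text \<open>\<open>rebracket C c m n : c\<^sup>m \<otimes> c\<^sup>n \<rightarrow> c\<^sup>m\<^sup>+\<^sup>n\<close>.\<close>

fun rebracket :: "('o, 'a, 'x) monoidal_scheme \<Rightarrow> 'o \<Rightarrow> nat \<Rightarrow> nat \<Rightarrow> 'a" where
  "rebracket C c m 0 = RUnit C (tensor_power C c m)"
| "rebracket C c 0 (Suc n) = LUnit C (tensor_power C c (Suc n))"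
| "rebracket C c (Suc m) (Suc 0) = Ident C (tensor_power C c (Suc m) \<otimes>\<^bsub>C\<^esub> c)"
| "rebracket C c (Suc m) (Suc (Suc n)) =
     (rebracket C c (Suc m) (Suc n) \<boxtimes>\<^bsub>C\<^esub> Ident C c)
       \<cdot>\<^bsub>C\<^esub> inv_arr C (Assoc C (tensor_power C c (Suc m)) (tensor_power C c (Suc n)) c)"

text \<open>\<open>interchange C a b c d : (a \<otimes> b) \<otimes> (c \<otimes> d) \<rightarrow> (a \<otimes> c) \<otimes> (b \<otimes> d)\<close>.\<close>

definition interchange :: "('o, 'a, 'x) monoidal_scheme \<Rightarrow> 'o \<Rightarrow> 'o \<Rightarrow> 'o \<Rightarrow> 'o \<Rightarrow> 'a" where
  "interchange C a b c d =
     inv_arr C (Assoc C a c (b \<otimes>\<^bsub>C\<^esub> d))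
       \<cdot>\<^bsub>C\<^esub> (Ident C a \<boxtimes>\<^bsub>C\<^esub>
            (Assoc C c b d \<cdot>\<^bsub>C\<^esub> (Braid C b c \<boxtimes>\<^bsub>C\<^esub> Ident C d) \<cdot>\<^bsub>C\<^esub> inv_arr C (Assoc C b c d)))
       \<cdot>\<^bsub>C\<^esub> Assoc C a b (c \<otimes>\<^bsub>C\<^esub> d)"

text \<open>\<open>shuffle C c d n : c\<^sup>n \<otimes> d\<^sup>n \<rightarrow> (c \<otimes> d)\<^sup>n\<close>.\<close>

fun shuffle :: "('o, 'a, 'x) monoidal_scheme \<Rightarrow> 'o \<Rightarrow> 'o \<Rightarrow> nat \<Rightarrow> 'a" where
  "shuffle C c d 0 = LUnit C (Unit C)"
| "shuffle C c d (Suc 0) = Ident C (c \<otimes>\<^bsub>C\<^esub> d)"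
| "shuffle C c d (Suc (Suc n)) =
     (shuffle C c d (Suc n) \<boxtimes>\<^bsub>C\<^esub> Ident C (c \<otimes>\<^bsub>C\<^esub> d))
       \<cdot>\<^bsub>C\<^esub> interchange C (tensor_power C c (Suc n)) c (tensor_power C d (Suc n)) d"

text \<open>\<open>unit_power C n : I \<rightarrow> I\<^sup>n\<close>.\<close>

fun unit_power :: "('o, 'a, 'x) monoidal_scheme \<Rightarrow> nat \<Rightarrow> 'a" where
  "unit_power C 0 = Ident C (Unit C)"
| "unit_power C (Suc 0) = Ident C (Unit C)"
| "unit_power C (Suc (Suc n)) =
     (unit_power C (Suc n) \<boxtimes>\<^bsub>C\<^esub> Ident C (Unit C)) \<cdot>\<^bsub>C\<^esub> inv_arr C (LUnit C (Unit C))"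

text \<open>Formal tensor words over a set of letters.  If no letter is repeated in \<open>w\<close>, then
  \<open>structural C v w f u\<close> says that \<open>f\<close> is the canonical isomorphism from \<open>w\<close> to \<open>u\<close>, interpreted
  in \<open>C\<close> along \<open>v\<close>; its permutation is read off from the positions of the letters.\<close>

datatype 'l word = Emp | Letter 'l | Tens "'l word" "'l word"

primrec word_obj :: "('o, 'a, 'x) monoidal_scheme \<Rightarrow> ('l \<Rightarrow> 'o) \<Rightarrow> 'l word \<Rightarrow> 'o" where
  "word_obj C v Emp = Unit C"
| "word_obj C v (Letter l) = v l"
| "word_obj C v (Tens w u) = word_obj C v w \<otimes>\<^bsub>C\<^esub> word_obj C v u"

inductive structural :: "('o, 'a, 'x) monoidal_scheme \<Rightarrow> ('l \<Rightarrow> 'o)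
    \<Rightarrow> 'l word \<Rightarrow> 'a \<Rightarrow> 'l word \<Rightarrow> bool"
  for C v where
  s_id: "structural C v w (Ident C (word_obj C v w)) w"
| s_assoc: "structural C v (Tens (Tens w u) t)
    (Assoc C (word_obj C v w) (word_obj C v u) (word_obj C v t)) (Tens w (Tens u t))"
| s_lunit: "structural C v (Tens Emp w) (LUnit C (word_obj C v w)) w"
| s_runit: "structural C v (Tens w Emp) (RUnit C (word_obj C v w)) w"
| s_braid: "structural C v (Tens w u) (Braid C (word_obj C v w) (word_obj C v u)) (Tens u w)"
| s_inv: "structural C v w f u \<Longrightarrow> structural C v u (inv_arr C f) w"
| s_comp: "\<lbrakk>structural C v w f u; structural C v u g t\<rbrakk> \<Longrightarrow> structural C v w (g \<cdot>\<^bsub>C\<^esub> f) t"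
| s_tensor: "\<lbrakk>structural C v w f u; structural C v w' f' u'\<rbrakk>
    \<Longrightarrow> structural C v (Tens w w') (f \<boxtimes>\<^bsub>C\<^esub> f') (Tens u u')"

text \<open>\<open>word_prod w n\<close> is the left-bracketed product of \<open>w 0, \<dots>, w (n - 1)\<close>.\<close>

fun word_prod :: "(nat \<Rightarrow> 'l word) \<Rightarrow> nat \<Rightarrow> 'l word" where
  "word_prod w 0 = Emp"
| "word_prod w (Suc 0) = w 0"
| "word_prod w (Suc (Suc n)) = Tens (word_prod w (Suc n)) (w (Suc n))"

lemma word_obj_word_prod:
  assumes "\<And>i. word_obj C v (w i) = c"
  shows "word_obj C v (word_prod w n) = tensor_power C c n"
  using assms by (induction w n rule: word_prod.induct) auto

lemma structural_rebracket:
  "structural C (\<lambda>_. c)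
     (Tens (word_prod (\<lambda>i. Letter i) m) (word_prod (\<lambda>i. Letter (m + i)) n))
     (rebracket C c m n) (word_prod (\<lambda>i. Letter i) (m + n))"
proof (induction C c m n rule: rebracket.induct)
  case (1 C c m)
  show ?case
    using s_runit[of C "\<lambda>_. c" "word_prod (\<lambda>i. Letter i) m"] by (simp add: word_obj_word_prod)
next
  case (2 C c n)
  show ?case
    using s_lunit[of C "\<lambda>_. c" "word_prod (\<lambda>i. Letter i) (Suc n)"]
    by (simp add: word_obj_word_prod)
next
  case (3 C c m)
  show ?case
    using s_id[of C "\<lambda>_. c" "word_prod (\<lambda>i. Letter i) (Suc (Suc m))"]
    by (simp add: word_obj_word_prod)
next
  case (4 C c m n)
  let ?a = "word_prod (\<lambda>i. Letter i) (Suc m)"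
    and ?b = "word_prod (\<lambda>i. Letter (Suc m + i)) (Suc n)"
    and ?l = "Letter (Suc m + Suc n) :: nat word"
  have "structural C (\<lambda>_. c) (Tens ?a (Tens ?b ?l))
      (inv_arr C (Assoc C (tensor_power C c (Suc m)) (tensor_power C c (Suc n)) c))
      (Tens (Tens ?a ?b) ?l)"
    using s_inv[OF s_assoc[of C "\<lambda>_. c" ?a ?b ?l]]
    by (simp add: word_obj_word_prod)
  from s_comp[OF this s_tensor[OF 4 s_id[of C "\<lambda>_. c" ?l]]]
  show ?case by simp
qed

lemma structural_interchange:
  "structural C v (Tens (Tens w u) (Tens w' u'))
     (interchange C (word_obj C v w) (word_obj C v u) (word_obj C v w') (word_obj C v u'))
     (Tens (Tens w w') (Tens u u'))"
proof -
  have 1: "structural C v (Tens u (Tens w' u'))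
      (Assoc C (word_obj C v w') (word_obj C v u) (word_obj C v u')
        \<cdot>\<^bsub>C\<^esub> (Braid C (word_obj C v u) (word_obj C v w') \<boxtimes>\<^bsub>C\<^esub> Ident C (word_obj C v u'))
        \<cdot>\<^bsub>C\<^esub> inv_arr C (Assoc C (word_obj C v u) (word_obj C v w') (word_obj C v u')))
      (Tens w' (Tens u u'))"
    by (rule s_comp[OF s_inv[OF s_assoc] s_comp[OF s_tensor[OF s_braid s_id] s_assoc],
          unfolded word_obj.simps])
  show ?thesis
    unfolding interchange_def
    using s_comp[OF s_assoc s_comp[OF s_tensor[OF s_id 1] s_inv[OF s_assoc]]] by simp
qed

lemma structural_shuffle:
  "structural C (case_sum (\<lambda>_. c) (\<lambda>_. d))
     (Tens (word_prod (\<lambda>i. Letter (Inl i)) n) (word_prod (\<lambda>i. Letter (Inr i)) n))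
     (shuffle C c d n)
     (word_prod (\<lambda>i. Tens (Letter (Inl i)) (Letter (Inr i))) n)"
proof (induction C c d n rule: shuffle.induct)
  case (1 C c d)
  show ?case
    using s_lunit[of C "case_sum (\<lambda>_. c) (\<lambda>_. d)" Emp] by simp
next
  case (2 C c d)
  show ?case
    using s_id[of C "case_sum (\<lambda>_. c) (\<lambda>_. d)" "Tens (Letter (Inl 0)) (Letter (Inr 0))"] by simp
next
  case (3 C c d n)
  let ?v = "case_sum (\<lambda>_. c) (\<lambda>_. d) :: nat + nat \<Rightarrow> _"
  let ?w = "word_prod (\<lambda>i. Letter (Inl i)) (Suc n)" and ?x = "Letter (Inl (Suc n))"
    and ?w' = "word_prod (\<lambda>i. Letter (Inr i)) (Suc n)" and ?x' = "Letter (Inr (Suc n))"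
  have "word_obj C ?v ?w = tensor_power C c (Suc n)" "word_obj C ?v ?w' = tensor_power C d (Suc n)"
    by (rule word_obj_word_prod; simp)+
  then show ?case
    using s_comp[OF structural_interchange[of C ?v ?w ?x ?w' ?x']
      s_tensor[OF 3 s_id[of C ?v "Tens ?x ?x'"]]]
    by simp
qed

lemma structural_unit_power:
  "structural C v Emp (unit_power C n) (word_prod (\<lambda>_. Emp) n)"
proof (induction C n rule: unit_power.induct)
  case (1 C)
  show ?case using s_id[of C v Emp] by simp
next
  case (2 C)
  show ?case using s_id[of C v Emp] by simp
next
  case (3 C n)
  show ?case
    using s_comp[OF s_inv[OF s_lunit[of C v Emp]] s_tensor[OF 3 s_id[of C v Emp]]] by simp
qed


section \<open>Supplies\<close>

text \<open>The unit strongator \<open>I \<rightarrow> s\<^sub>c(0) = I\<close> is not prescribed: the unit axiom of a monoidal functor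
  together with \<open>supply_strongator\<close> forces it to be the identity.\<close>

locale prop_supply = P: prop_category P + C: symmetric_monoidal_category C
  for P :: "(nat, 'p, 'x) monoidal_scheme"
    and C :: "('o, 'a, 'y) monoidal_scheme"
    and s :: "'o \<Rightarrow> (nat, 'p, 'o, 'a) monoidal_functor" +
  assumes supply_functor: "c \<in> Obj C \<Longrightarrow> strong_monoidal_functor P C (s c)"
    and supply_obj: "c \<in> Obj C \<Longrightarrow> ObjMap (s c) m = tensor_power C c m"
    and supply_strongator: "c \<in> Obj C \<Longrightarrow> Mult (s c) m n = rebracket C c m n"
    and supply_tensor: "\<lbrakk>c \<in> Obj C; d \<in> Obj C; \<mu> \<in> hom P m n\<rbrakk>
      \<Longrightarrow> ArrMap (s (c \<otimes>\<^bsub>C\<^esub> d)) \<mu> \<cdot>\<^bsub>C\<^esub> shuffle C c d m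
        = shuffle C c d n \<cdot>\<^bsub>C\<^esub> (ArrMap (s c) \<mu> \<boxtimes>\<^bsub>C\<^esub> ArrMap (s d) \<mu>)"
    and supply_unit: "\<mu> \<in> hom P m n
      \<Longrightarrow> ArrMap (s (Unit C)) \<mu> \<cdot>\<^bsub>C\<^esub> unit_power C m = unit_power C n"

end

theory Submission
  imports Defs
begin

text \<open>A prop functor is the identity on objects and has identity strongators, so \<open>s\<^sub>c \<circ> F\<close> has the
  same objects and strongators as \<open>s\<^sub>c\<close>, and its compatibility with \<open>\<otimes>\<close> and \<open>I\<close> at \<open>\<mu>\<close> is that of
  \<open>s\<close> at \<open>F \<mu>\<close>. What remains is that strong monoidal functors compose.\<close>

section \<open>Arrows with explicit endpoints: composition, associativity, isomorphisms\<close>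

context category
begin

text \<open>Typing by equations on \<open>Dom\<close> and \<open>Cod\<close> lets the simplifier
  check composability without guessing the intermediate objects over which the locale axioms
  quantify. The rules below restate those axioms in this style.\<close>

lemma hom_iff: "f \<in> hom C a b \<longleftrightarrow> f \<in> Arr C \<and> Dom C f = a \<and> Cod C f = b"
  by (simp add: hom_def)

lemma Ident_simps:
  assumes "a \<in> Obj C"
  shows "Ident C a \<in> Arr C" "Dom C (Ident C a) = a" "Cod C (Ident C a) = a"
  using id_hom[OF assms] by (simp_all add: hom_iff)

lemma Comp_simps:
  assumes "f \<in> Arr C" "g \<in> Arr C" "Dom C g = Cod C f"
  shows "g \<cdot> f \<in> Arr C" "Dom C (g \<cdot> f) = Dom C f" "Cod C (g \<cdot> f) = Cod C g"
  using comp_hom[of f "Dom C f" "Cod C f" g "Cod C g"] assms by (simp_all add: hom_iff)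

lemma Comp_Ident_left: "f \<in> Arr C \<Longrightarrow> Cod C f = b \<Longrightarrow> Ident C b \<cdot> f = f"
  using comp_id_left[of f "Dom C f" b] by (simp add: hom_iff)

text \<open>Oriented opposite to \<open>comp_assoc\<close>: as a rewrite rule it brackets composites
  to the right.\<close>

lemma Comp_assoc:
  "\<lbrakk>f \<in> Arr C; g \<in> Arr C; h \<in> Arr C; Dom C g = Cod C f; Dom C h = Cod C g\<rbrakk>
    \<Longrightarrow> (h \<cdot> g) \<cdot> f = h \<cdot> (g \<cdot> f)"
  using comp_assoc[of f "Dom C f" "Cod C f" g "Cod C g" h "Cod C h"] by (simp add: hom_iff)

lemma is_iso_comp:
  assumes "is_iso C f" "is_iso C g" "Dom C g = Cod C f"
  shows "is_iso C (g \<cdot> f)"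
proof -
  obtain f' g' where f: "inverse_arrows C f f'" and g: "inverse_arrows C g g'"
    using assms by (auto simp: is_iso_def)
  \<comment> \<open>These are the inner cancellations that remain once the two composites of
    \<open>g \<cdot> f\<close> with its candidate inverse \<open>f' \<cdot> g'\<close> are bracketed
    to the right.\<close>
  have "g' \<cdot> (g \<cdot> f) = f"
    using f g assms(3) Comp_assoc[of f g g'] by (simp add: inverse_arrows_def hom_iff Comp_Ident_left)
  moreover have "f \<cdot> (f' \<cdot> g') = g'"
    using f g assms(3) Comp_assoc[of g' f' f] by (simp add: inverse_arrows_def hom_iff Comp_Ident_left)
  ultimately have "inverse_arrows C (g \<cdot> f) (f' \<cdot> g')"
    using f g assms(3) by (simp add: inverse_arrows_def hom_iff Comp_simps Comp_assoc)
  then show ?thesis by (auto simp: is_iso_def)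
qed

end

section \<open>Tensor products and structure isomorphisms\<close>

context symmetric_monoidal_category
begin

lemma Tensor_simps:
  assumes "f \<in> Arr C" "g \<in> Arr C"
  shows "f \<boxtimes> g \<in> Arr C" "Dom C (f \<boxtimes> g) = Dom C f \<otimes> Dom C g"
    "Cod C (f \<boxtimes> g) = Cod C f \<otimes> Cod C g"
  using tensor_hom[of f "Dom C f" "Cod C f" g "Dom C g" "Cod C g"] assms
  by (simp_all add: hom_iff)

text \<open>Bifunctoriality, with the identity factor read as
  \<open>Ident C c \<cdot> Ident C c\<close>.\<close>

lemma comp_tensor_Ident:
  assumes "f \<in> Arr C" "g \<in> Arr C" "Dom C g = Cod C f" "c \<in> Obj C"
  shows "(g \<cdot> f) \<boxtimes> Ident C c = (g \<boxtimes> Ident C c) \<cdot> (f \<boxtimes> Ident C c)"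
  using tensor_comp[of f "Dom C f" "Cod C f" g "Cod C g" "Ident C c" c c "Ident C c" c] assms
  by (simp add: hom_iff Ident_simps Comp_Ident_left)

lemma Ident_tensor_comp:
  assumes "f \<in> Arr C" "g \<in> Arr C" "Dom C g = Cod C f" "c \<in> Obj C"
  shows "Ident C c \<boxtimes> (g \<cdot> f) = (Ident C c \<boxtimes> g) \<cdot> (Ident C c \<boxtimes> f)"
  using tensor_comp[of "Ident C c" c c "Ident C c" c f "Dom C f" "Cod C f" g "Cod C g"] assms
  by (simp add: hom_iff Ident_simps Comp_Ident_left)

lemma Assoc_simps:
  assumes "a \<in> Obj C" "b \<in> Obj C" "c \<in> Obj C"
  shows "Assoc C a b c \<in> Arr C" "Dom C (Assoc C a b c) = (a \<otimes> b) \<otimes> c"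
    "Cod C (Assoc C a b c) = a \<otimes> (b \<otimes> c)"
  using assoc_hom[OF assms] by (simp_all add: hom_iff)

lemma LUnit_simps:
  assumes "a \<in> Obj C"
  shows "LUnit C a \<in> Arr C" "Dom C (LUnit C a) = Unit C \<otimes> a" "Cod C (LUnit C a) = a"
  using lunit_hom[OF assms] by (simp_all add: hom_iff)

lemma RUnit_simps:
  assumes "a \<in> Obj C"
  shows "RUnit C a \<in> Arr C" "Dom C (RUnit C a) = a \<otimes> Unit C" "Cod C (RUnit C a) = a"
  using runit_hom[OF assms] by (simp_all add: hom_iff)

lemma Braid_simps:
  assumes "a \<in> Obj C" "b \<in> Obj C"
  shows "Braid C a b \<in> Arr C" "Dom C (Braid C a b) = a \<otimes> b" "Cod C (Braid C a b) = b \<otimes> a"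
  using braid_hom[OF assms] by (simp_all add: hom_iff)

lemmas arrow_simps = unit_obj tensor_obj Ident_simps Comp_simps Tensor_simps
  Assoc_simps LUnit_simps RUnit_simps Braid_simps

end

section \<open>Images of arrows and strongators under a functor\<close>

context strong_monoidal_functor
begin

lemma ArrMap_simps:
  assumes "f \<in> Arr A"
  shows "ArrMap F f \<in> Arr B" "Dom B (ArrMap F f) = ObjMap F (Dom A f)"
    "Cod B (ArrMap F f) = ObjMap F (Cod A f)"
  using map_hom[of f "Dom A f" "Cod A f"] assms by (simp_all add: A.hom_iff B.hom_iff)

lemma Mult_simps:
  assumes "a \<in> Obj A" "b \<in> Obj A"
  shows "Mult F a b \<in> Arr B" "Dom B (Mult F a b) = ObjMap F a \<otimes>\<^bsub>B\<^esub> ObjMap F b"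
    "Cod B (Mult F a b) = ObjMap F (a \<otimes>\<^bsub>A\<^esub> b)"
  using mult_hom[OF assms] by (simp_all add: B.hom_iff)

lemma MultUnit_simps:
  "MultUnit F \<in> Arr B" "Dom B (MultUnit F) = Unit B" "Cod B (MultUnit F) = ObjMap F (Unit A)"
  using eps_hom by (simp_all add: B.hom_iff)

lemmas functor_simps = map_obj ArrMap_simps Mult_simps MultUnit_simps

lemma ArrMap_comp:
  "\<lbrakk>f \<in> Arr A; g \<in> Arr A; Dom A g = Cod A f\<rbrakk>
    \<Longrightarrow> ArrMap F (g \<cdot>\<^bsub>A\<^esub> f) = ArrMap F g \<cdot>\<^bsub>B\<^esub> ArrMap F f"
  using map_comp[of f "Dom A f" "Cod A f" g "Cod A g"] by (simp add: A.hom_iff)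

lemma Mult_natural:
  "\<lbrakk>f \<in> Arr A; g \<in> Arr A\<rbrakk> \<Longrightarrow>
    Mult F (Cod A f) (Cod A g) \<cdot>\<^bsub>B\<^esub> (ArrMap F f \<boxtimes>\<^bsub>B\<^esub> ArrMap F g)
      = ArrMap F (f \<boxtimes>\<^bsub>A\<^esub> g) \<cdot>\<^bsub>B\<^esub> Mult F (Dom A f) (Dom A g)"
  using mult_natural[of f "Dom A f" "Cod A f" g "Dom A g" "Cod A g"] by (simp add: A.hom_iff)

text \<open>Functoriality carries an inverse pair to an inverse pair. This serves the strongators of
  a composite functor, whose first factor is the image of a strongator.\<close>

lemma is_iso_ArrMap:
  assumes "is_iso A f"
  shows "is_iso B (ArrMap F f)"
proof -
  obtain g where g: "inverse_arrows A f g"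
    using assms by (auto simp: is_iso_def)
  then have "ArrMap F g \<cdot>\<^bsub>B\<^esub> ArrMap F f = Ident B (ObjMap F (Dom A f))"
    "ArrMap F f \<cdot>\<^bsub>B\<^esub> ArrMap F g = Ident B (ObjMap F (Cod A f))"
    by (simp_all flip: ArrMap_comp
        add: inverse_arrows_def A.hom_iff map_id A.dom_obj A.cod_obj)
  then have "inverse_arrows B (ArrMap F f) (ArrMap F g)"
    using g by (simp add: inverse_arrows_def A.hom_iff B.hom_iff ArrMap_simps)
  then show ?thesis by (auto simp: is_iso_def)
qed

end

section \<open>Composition of strong monoidal functors\<close>

text \<open>Each coherence law of the composite is the law of \<open>F\<close>, transported along
  \<open>G\<close>, pasted to the law of \<open>G\<close>. Naturality of \<open>Mult G\<close>
  separates the two layers.\<close>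

lemma strong_monoidal_functor_comp:
  assumes "strong_monoidal_functor A B F" "strong_monoidal_functor B C G"
  shows "strong_monoidal_functor A C (comp_functor C G F)"
proof -
  interpret F: strong_monoidal_functor A B F by fact
  interpret G: strong_monoidal_functor B C G by fact
  note simps = F.A.arrow_simps F.B.arrow_simps G.B.arrow_simps F.functor_simps G.functor_simps
  let ?H = "comp_functor C G F"
  have H: "ObjMap ?H a = ObjMap G (ObjMap F a)" "ArrMap ?H f = ArrMap G (ArrMap F f)"
    "Mult ?H a b = ArrMap G (Mult F a b) \<cdot>\<^bsub>C\<^esub> Mult G (ObjMap F a) (ObjMap F b)"
    "MultUnit ?H = ArrMap G (MultUnit F) \<cdot>\<^bsub>C\<^esub> MultUnit G" for a b f
    by (simp_all add: comp_functor_def)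
  \<comment> \<open>The pasting step: naturality slides a tensor of images under \<open>G\<close>
    across \<open>Mult G\<close>, so that everything coming from \<open>F\<close> is gathered under
    one \<open>ArrMap G\<close>. The arrows \<open>f\<close> and \<open>g\<close> are arbitrary in
    \<open>B\<close>, since strongators of \<open>F\<close> and identities are substituted for them
    below.\<close>
  have Mult_comp_tensor: "Mult ?H a b \<cdot>\<^bsub>C\<^esub> (ArrMap G f \<boxtimes>\<^bsub>C\<^esub> ArrMap G g) =
      ArrMap G (Mult F a b \<cdot>\<^bsub>B\<^esub> (f \<boxtimes>\<^bsub>B\<^esub> g)) \<cdot>\<^bsub>C\<^esub> Mult G (Dom B f) (Dom B g)"
    if "a \<in> Obj A" "b \<in> Obj A" "f \<in> Arr B" "g \<in> Arr B" "Cod B f = ObjMap F a" "Cod B g = ObjMap F b"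
    for a b f g
    using that G.Mult_natural[of f g] F.B.dom_obj[of f] F.B.dom_obj[of g]
    by (simp add: H simps G.ArrMap_comp G.B.Comp_assoc)
  show ?thesis
  proof
    show "Mult ?H a' b' \<cdot>\<^bsub>C\<^esub> (ArrMap ?H f \<boxtimes>\<^bsub>C\<^esub> ArrMap ?H g)
        = ArrMap ?H (f \<boxtimes>\<^bsub>A\<^esub> g) \<cdot>\<^bsub>C\<^esub> Mult ?H a b"
      if "f \<in> hom A a a'" "g \<in> hom A b b'" for f g a a' b b'
    proof -
      have fg: "f \<in> Arr A" "g \<in> Arr A" "Dom A f = a" "Cod A f = a'" "Dom A g = b" "Cod A g = b'"
        "a \<in> Obj A" "b \<in> Obj A" "a' \<in> Obj A" "b' \<in> Obj A"
        using that F.A.dom_obj F.A.cod_obj by (auto simp: F.A.hom_iff)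
      have "Mult ?H a' b' \<cdot>\<^bsub>C\<^esub> (ArrMap ?H f \<boxtimes>\<^bsub>C\<^esub> ArrMap ?H g)
          = ArrMap G (Mult F a' b' \<cdot>\<^bsub>B\<^esub> (ArrMap F f \<boxtimes>\<^bsub>B\<^esub> ArrMap F g))
            \<cdot>\<^bsub>C\<^esub> Mult G (ObjMap F a) (ObjMap F b)"
        using fg Mult_comp_tensor[of a' b' "ArrMap F f" "ArrMap F g"] by (simp add: H(2) simps)
      also have "\<dots> = ArrMap ?H (f \<boxtimes>\<^bsub>A\<^esub> g) \<cdot>\<^bsub>C\<^esub> Mult ?H a b"
        unfolding F.mult_natural[OF that]
        using fg by (simp add: H simps G.ArrMap_comp G.B.Comp_assoc)
      finally show ?thesis .
    qed
    show "ArrMap ?H (Assoc A a b c) \<cdot>\<^bsub>C\<^esub> Mult ?H (a \<otimes>\<^bsub>A\<^esub> b) c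
          \<cdot>\<^bsub>C\<^esub> (Mult ?H a b \<boxtimes>\<^bsub>C\<^esub> Ident C (ObjMap ?H c))
        = Mult ?H a (b \<otimes>\<^bsub>A\<^esub> c) \<cdot>\<^bsub>C\<^esub> (Ident C (ObjMap ?H a) \<boxtimes>\<^bsub>C\<^esub> Mult ?H b c)
          \<cdot>\<^bsub>C\<^esub> Assoc C (ObjMap ?H a) (ObjMap ?H b) (ObjMap ?H c)"
      if o: "a \<in> Obj A" "b \<in> Obj A" "c \<in> Obj A" for a b c
    proof -
      let ?a = "ObjMap F a" and ?b = "ObjMap F b" and ?c = "ObjMap F c"
      \<comment> \<open>The strongator in the tensor is split into its \<open>F\<close> and
        \<open>G\<close> factors; the \<open>F\<close> factor then slides left, the identity beside
        it being the image of \<open>Ident B ?c\<close>. Bracketing to the left makes the sliding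
        rule match.\<close>
      have l: "Mult ?H (a \<otimes>\<^bsub>A\<^esub> b) c \<cdot>\<^bsub>C\<^esub> (Mult ?H a b \<boxtimes>\<^bsub>C\<^esub> Ident C (ObjMap ?H c))
          = ArrMap G (Mult F (a \<otimes>\<^bsub>A\<^esub> b) c \<cdot>\<^bsub>B\<^esub> (Mult F a b \<boxtimes>\<^bsub>B\<^esub> Ident B ?c))
            \<cdot>\<^bsub>C\<^esub> (Mult G (?a \<otimes>\<^bsub>B\<^esub> ?b) ?c \<cdot>\<^bsub>C\<^esub> (Mult G ?a ?b \<boxtimes>\<^bsub>C\<^esub> Ident C (ObjMap G ?c)))"
        using o Mult_comp_tensor[of "a \<otimes>\<^bsub>A\<^esub> b" c "Mult F a b" "Ident B ?c"]
        by (simp add: H simps G.map_id G.B.comp_tensor_Ident G.B.Comp_assoc[symmetric])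
      have r: "Mult ?H a (b \<otimes>\<^bsub>A\<^esub> c) \<cdot>\<^bsub>C\<^esub> (Ident C (ObjMap ?H a) \<boxtimes>\<^bsub>C\<^esub> Mult ?H b c)
          = ArrMap G (Mult F a (b \<otimes>\<^bsub>A\<^esub> c) \<cdot>\<^bsub>B\<^esub> (Ident B ?a \<boxtimes>\<^bsub>B\<^esub> Mult F b c))
            \<cdot>\<^bsub>C\<^esub> (Mult G ?a (?b \<otimes>\<^bsub>B\<^esub> ?c) \<cdot>\<^bsub>C\<^esub> (Ident C (ObjMap G ?a) \<boxtimes>\<^bsub>C\<^esub> Mult G ?b ?c))"
        using o Mult_comp_tensor[of a "b \<otimes>\<^bsub>A\<^esub> c" "Ident B ?a" "Mult F b c"]
        by (simp add: H simps G.map_id G.B.Ident_tensor_comp G.B.Comp_assoc[symmetric])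
      \<comment> \<open>Bracketed to the right, unlike the goal, so that \<open>l\<close> matches
        the last two factors.\<close>
      have "ArrMap ?H (Assoc A a b c) \<cdot>\<^bsub>C\<^esub> (Mult ?H (a \<otimes>\<^bsub>A\<^esub> b) c
            \<cdot>\<^bsub>C\<^esub> (Mult ?H a b \<boxtimes>\<^bsub>C\<^esub> Ident C (ObjMap ?H c)))
          = ArrMap G (ArrMap F (Assoc A a b c) \<cdot>\<^bsub>B\<^esub> Mult F (a \<otimes>\<^bsub>A\<^esub> b) c
              \<cdot>\<^bsub>B\<^esub> (Mult F a b \<boxtimes>\<^bsub>B\<^esub> Ident B ?c))
            \<cdot>\<^bsub>C\<^esub> (Mult G (?a \<otimes>\<^bsub>B\<^esub> ?b) ?c \<cdot>\<^bsub>C\<^esub> (Mult G ?a ?b \<boxtimes>\<^bsub>C\<^esub> Ident C (ObjMap G ?c)))"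
        unfolding l using o by (simp add: H simps G.ArrMap_comp G.B.Comp_assoc)
      \<comment> \<open>The law of \<open>F\<close> inside \<open>G\<close> trades
        \<open>Assoc A\<close> for \<open>Assoc B\<close>; the image of \<open>Assoc B\<close> is
        split off because the law of \<open>G\<close> starts with it.\<close>
      also have "\<dots> = ArrMap G (Mult F a (b \<otimes>\<^bsub>A\<^esub> c) \<cdot>\<^bsub>B\<^esub> (Ident B ?a \<boxtimes>\<^bsub>B\<^esub> Mult F b c))
          \<cdot>\<^bsub>C\<^esub> (ArrMap G (Assoc B ?a ?b ?c) \<cdot>\<^bsub>C\<^esub> Mult G (?a \<otimes>\<^bsub>B\<^esub> ?b) ?c
            \<cdot>\<^bsub>C\<^esub> (Mult G ?a ?b \<boxtimes>\<^bsub>C\<^esub> Ident C (ObjMap G ?c)))"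
        unfolding F.mult_assoc[OF o] using o by (simp add: simps G.ArrMap_comp G.B.Comp_assoc)
      also have "\<dots> = Mult ?H a (b \<otimes>\<^bsub>A\<^esub> c) \<cdot>\<^bsub>C\<^esub> (Ident C (ObjMap ?H a) \<boxtimes>\<^bsub>C\<^esub> Mult ?H b c)
          \<cdot>\<^bsub>C\<^esub> Assoc C (ObjMap ?H a) (ObjMap ?H b) (ObjMap ?H c)"
        unfolding r G.mult_assoc[OF o[THEN F.map_obj]]
        using o by (simp add: H simps G.B.Comp_assoc)
      finally show ?thesis
        using o by (simp add: H simps G.B.Comp_assoc)
    qed
    show "ArrMap ?H (LUnit A a) \<cdot>\<^bsub>C\<^esub> Mult ?H (Unit A) a
          \<cdot>\<^bsub>C\<^esub> (MultUnit ?H \<boxtimes>\<^bsub>C\<^esub> Ident C (ObjMap ?H a)) = LUnit C (ObjMap ?H a)"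
      if o: "a \<in> Obj A" for a
    proof -
      let ?a = "ObjMap F a"
      have l: "Mult ?H (Unit A) a \<cdot>\<^bsub>C\<^esub> (MultUnit ?H \<boxtimes>\<^bsub>C\<^esub> Ident C (ObjMap ?H a))
          = ArrMap G (Mult F (Unit A) a \<cdot>\<^bsub>B\<^esub> (MultUnit F \<boxtimes>\<^bsub>B\<^esub> Ident B ?a))
            \<cdot>\<^bsub>C\<^esub> (Mult G (Unit B) ?a \<cdot>\<^bsub>C\<^esub> (MultUnit G \<boxtimes>\<^bsub>C\<^esub> Ident C (ObjMap G ?a)))"
        using o Mult_comp_tensor[of "Unit A" a "MultUnit F" "Ident B ?a"]
        by (simp add: H simps G.map_id G.B.comp_tensor_Ident G.B.Comp_assoc[symmetric])
      have "ArrMap ?H (LUnit A a) \<cdot>\<^bsub>C\<^esub> (Mult ?H (Unit A) a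
            \<cdot>\<^bsub>C\<^esub> (MultUnit ?H \<boxtimes>\<^bsub>C\<^esub> Ident C (ObjMap ?H a)))
          = ArrMap G (ArrMap F (LUnit A a) \<cdot>\<^bsub>B\<^esub> Mult F (Unit A) a
              \<cdot>\<^bsub>B\<^esub> (MultUnit F \<boxtimes>\<^bsub>B\<^esub> Ident B ?a))
            \<cdot>\<^bsub>C\<^esub> Mult G (Unit B) ?a \<cdot>\<^bsub>C\<^esub> (MultUnit G \<boxtimes>\<^bsub>C\<^esub> Ident C (ObjMap G ?a))"
        unfolding l using o by (simp add: H simps G.ArrMap_comp G.B.Comp_assoc)
      \<comment> \<open>The unit law of \<open>F\<close> collapses the argument of
        \<open>ArrMap G\<close> to \<open>LUnit B ?a\<close>, which leaves exactly the unit law of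
        \<open>G\<close> at \<open>?a\<close>.\<close>
      also have "\<dots> = LUnit C (ObjMap ?H a)"
        unfolding F.mult_lunit[OF o] using G.mult_lunit[OF F.map_obj[OF o]] by (simp add: H)
      finally show ?thesis
        using o by (simp add: H simps G.B.Comp_assoc)
    qed
    show "ArrMap ?H (RUnit A a) \<cdot>\<^bsub>C\<^esub> Mult ?H a (Unit A)
          \<cdot>\<^bsub>C\<^esub> (Ident C (ObjMap ?H a) \<boxtimes>\<^bsub>C\<^esub> MultUnit ?H) = RUnit C (ObjMap ?H a)"
      if o: "a \<in> Obj A" for a
    proof -
      let ?a = "ObjMap F a"
      have l: "Mult ?H a (Unit A) \<cdot>\<^bsub>C\<^esub> (Ident C (ObjMap ?H a) \<boxtimes>\<^bsub>C\<^esub> MultUnit ?H)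
          = ArrMap G (Mult F a (Unit A) \<cdot>\<^bsub>B\<^esub> (Ident B ?a \<boxtimes>\<^bsub>B\<^esub> MultUnit F))
            \<cdot>\<^bsub>C\<^esub> (Mult G ?a (Unit B) \<cdot>\<^bsub>C\<^esub> (Ident C (ObjMap G ?a) \<boxtimes>\<^bsub>C\<^esub> MultUnit G))"
        using o Mult_comp_tensor[of a "Unit A" "Ident B ?a" "MultUnit F"]
        by (simp add: H simps G.map_id G.B.Ident_tensor_comp G.B.Comp_assoc[symmetric])
      have "ArrMap ?H (RUnit A a) \<cdot>\<^bsub>C\<^esub> (Mult ?H a (Unit A)
            \<cdot>\<^bsub>C\<^esub> (Ident C (ObjMap ?H a) \<boxtimes>\<^bsub>C\<^esub> MultUnit ?H))
          = ArrMap G (ArrMap F (RUnit A a) \<cdot>\<^bsub>B\<^esub> Mult F a (Unit A)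
              \<cdot>\<^bsub>B\<^esub> (Ident B ?a \<boxtimes>\<^bsub>B\<^esub> MultUnit F))
            \<cdot>\<^bsub>C\<^esub> Mult G ?a (Unit B) \<cdot>\<^bsub>C\<^esub> (Ident C (ObjMap G ?a) \<boxtimes>\<^bsub>C\<^esub> MultUnit G)"
        unfolding l using o by (simp add: H simps G.ArrMap_comp G.B.Comp_assoc)
      also have "\<dots> = RUnit C (ObjMap ?H a)"
        unfolding F.mult_runit[OF o] using G.mult_runit[OF F.map_obj[OF o]] by (simp add: H)
      finally show ?thesis
        using o by (simp add: H simps G.B.Comp_assoc)
    qed
    show "ArrMap ?H (Braid A a b) \<cdot>\<^bsub>C\<^esub> Mult ?H a b
        = Mult ?H b a \<cdot>\<^bsub>C\<^esub> Braid C (ObjMap ?H a) (ObjMap ?H b)"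
      if o: "a \<in> Obj A" "b \<in> Obj A" for a b
    proof -
      let ?a = "ObjMap F a" and ?b = "ObjMap F b"
      have "ArrMap ?H (Braid A a b) \<cdot>\<^bsub>C\<^esub> Mult ?H a b
          = ArrMap G (ArrMap F (Braid A a b) \<cdot>\<^bsub>B\<^esub> Mult F a b) \<cdot>\<^bsub>C\<^esub> Mult G ?a ?b"
        using o by (simp add: H simps G.ArrMap_comp G.B.Comp_assoc)
      \<comment> \<open>The braiding passes \<open>Mult F\<close> under \<open>G\<close> here, and
        \<open>Mult G\<close> in the next step.\<close>
      also have "\<dots> = ArrMap G (Mult F b a) \<cdot>\<^bsub>C\<^esub> (ArrMap G (Braid B ?a ?b) \<cdot>\<^bsub>C\<^esub> Mult G ?a ?b)"
        unfolding F.mult_braid[OF o] using o by (simp add: simps G.ArrMap_comp G.B.Comp_assoc)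
      also have "\<dots> = Mult ?H b a \<cdot>\<^bsub>C\<^esub> Braid C (ObjMap ?H a) (ObjMap ?H b)"
        unfolding G.mult_braid[OF o[THEN F.map_obj]]
        using o by (simp add: H simps G.B.Comp_assoc)
      finally show ?thesis .
    qed
  \<comment> \<open>What remains is ordinary functoriality, the typing of the strongators, and their
    invertibility as composites of isomorphisms.\<close>
  qed (auto simp: H simps F.A.hom_iff G.B.hom_iff F.map_id G.map_id F.ArrMap_comp G.ArrMap_comp
      intro!: G.B.is_iso_comp G.is_iso_ArrMap F.mult_iso G.mult_iso F.eps_iso G.eps_iso)
qed

section \<open>Prop functors and the composite supply\<close>

text \<open>Strictness makes the object map an endomorphism of the monoid of natural numbers, which
  is determined by its value at the generator 1.\<close>

lemma (in prop_functor) ObjMap_eq: "ObjMap F n = n"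
proof (induction n)
  case 0
  show ?case using strict_unit by (simp add: P.prop_Unit Q.prop_Unit)
next
  case (Suc n)
  then show ?case
    using strict_tensor[of n 1] map_one by (simp add: P.prop_Obj P.prop_tensor Q.prop_tensor)
qed

theorem proposition3p21:
  fixes P :: "(nat, 'p, 'x) monoidal_scheme"
    and Q :: "(nat, 'q, 'y) monoidal_scheme"
    and F :: "(nat, 'p, nat, 'q) monoidal_functor"
    and C :: "('o, 'a, 'z) monoidal_scheme"
    and s :: "'o \<Rightarrow> (nat, 'q, 'o, 'a) monoidal_functor"
  assumes "prop_category P"
    and "prop_category Q"
    and "prop_functor P Q F"
    and "symmetric_monoidal_category C"
    and "prop_supply Q C s"
  shows "prop_supply P C (\<lambda>c. comp_functor C (s c) F)"
proof -
  interpret F: prop_functor P Q F by fact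
  interpret S: prop_supply Q C s by fact
  \<comment> \<open>As \<open>F\<close> fixes objects, the conditions of \<open>s\<close> at
    \<open>ArrMap F \<mu>\<close> carry the same exponents \<open>m\<close> and \<open>n\<close> as
    those required at \<open>\<mu>\<close>.\<close>
  have map_hom: "ArrMap F \<mu> \<in> hom Q m n" if "\<mu> \<in> hom P m n" for \<mu> m n
    using F.map_hom[OF that] by (simp add: F.ObjMap_eq)
  show ?thesis
  proof (rule prop_supply.intro[OF assms(1,4) prop_supply_axioms.intro])
    show "strong_monoidal_functor P C (comp_functor C (s c) F)" if "c \<in> Obj C" for c
      using F.strong_monoidal_functor_axioms S.supply_functor[OF that]
      by (rule strong_monoidal_functor_comp)
    show "Mult (comp_functor C (s c) F) m n = rebracket C c m n" if "c \<in> Obj C" for c m n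
    proof -
      interpret G: strong_monoidal_functor Q C "s c" using S.supply_functor[OF that] .
      \<comment> \<open>The left factor is the image of the strongator of \<open>F\<close>, the
        identity on \<open>m + n\<close>; \<open>s c\<close> sends it to an identity, which then
        cancels.\<close>
      have "Mult (comp_functor C (s c) F) m n = ArrMap (s c) (Ident Q (m + n)) \<cdot>\<^bsub>C\<^esub> Mult (s c) m n"
        by (simp add: comp_functor_def F.Mult_id F.P.prop_Obj F.ObjMap_eq F.Q.prop_tensor)
      also have "\<dots> = Mult (s c) m n"
        using G.Mult_simps[of m n]
        by (simp add: G.map_id F.Q.prop_Obj F.Q.prop_tensor S.C.Comp_Ident_left)
      finally show ?thesis
        using S.supply_strongator[OF that] by simp
    qed
  qed (simp_all add: comp_functor_def F.ObjMap_eq S.supply_obj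
      S.supply_tensor[OF _ _ map_hom] S.supply_unit[OF map_hom])
qed

end
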